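(* Let $\gamma=\frac{1+\sqrt5}2$ and $T:[0,1)^2\to[0,1)^2$, $T(x,y)=(y,\{-x-\gamma y\})$ (the map associated with $\lambda=-1/\gamma$). Then $\pi(z)$ is finite for all $z\in(\mathbb Z[\gamma]\cap[0,1))^2$, but $\pi\left(1-\frac1{3\gamma},1-\frac2{3\gamma}\right)=\infty$.
   Context: $\{u\}=u-\lfloor u\rfloor$ is the fractional part. $T$ is a bijection of $[0,1)^2$. $\pi(z)$ is the least $p\ge1$ with $T^p(z)=z$, and $\pi(z)=\infty$ if no such $p$ exists. *)

theory Defs
  imports Complex_Main "HOL-Library.Extended_Nat" "HOL-Computational_Algebra.Polynomial"
begin

definition golden :: real where
  "golden = (1 + sqrt 5) / 2"

definition Z_golden :: "real set" where
  "Z_golden = range (\<lambda>p :: int poly. poly (map_poly of_int p) golden)"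

definition unit_square :: "(real \<times> real) set" where
  "unit_square = {0..<1} \<times> {0..<1}"

(* Defined on the whole plane; only the restriction to unit_square, which is a
   bijection of unit_square by the lemma T_bij below, is relevant. *)
definition T :: "real \<times> real \<Rightarrow> real \<times> real" where
  "T = (\<lambda>(x, y). (y, frac (- x - golden * y)))"

definition period :: "('a \<Rightarrow> 'a) \<Rightarrow> 'a \<Rightarrow> enat" where
  "period f z =
     (if \<exists>p\<ge>1. (f ^^ p) z = z then enat (LEAST p. p \<ge> 1 \<and> (f ^^ p) z = z) else \<infinity>)"

lemma T_bij: "bij_betw T unit_square unit_square"
proof (rule bij_betw_byWitness[where f' = "\<lambda>(x, y). (frac (- y - golden * x), x)"])
  have *: "frac (- frac (- a - b) - b) = a" if "0 \<le> a" "a < 1" for a b :: real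
    using that by (subst frac_unique_iff) (auto simp: frac_def)
  show "\<forall>z\<in>unit_square. (\<lambda>(x, y). (frac (- y - golden * x), x)) (T z) = z"
    by (auto simp: unit_square_def T_def *)
  show "\<forall>z\<in>unit_square. T ((\<lambda>(x, y). (frac (- y - golden * x), x)) z) = z"
    by (auto simp: unit_square_def T_def *)
qed (auto simp: unit_square_def T_def frac_lt_1)

end

theory Submission
  imports Defs
begin

text \<open>
  The linear part \<open>(x, y) \<mapsto> (y, - x - \<gamma> y)\<close> of \<open>T\<close> has characteristic polynomial \<open>t\<^sup>2 + \<gamma> t + 1\<close>
  with roots \<open>exp (\<plusminus> 4 \<pi> \<i> / 5)\<close>, so it is a rotation of order five in suitable coordinates, and \<open>T\<close> is
  a piecewise rotation. Such a map is understood through a domain on which its first return map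
  repeats itself at a smaller scale.

  Here the domain is the triangle \<open>x, y \<ge> 0\<close>, \<open>x + y < 1\<close> without the origin, together with the map \<open>F\<close>
  that rotates its two halves separately. Let \<open>shrink\<close> be the scaling by \<open>2 - \<gamma> = 1 / \<gamma>\<^sup>2\<close>. On the shrunk
  triangle, \<open>T\<close> returns as a copy of \<open>F\<close> (\<open>T_induced\<close>), and \<open>F\<close> itself returns there as a copy of \<open>F\<close>
  (\<open>F_induced\<close>). Hence an \<open>F\<close>-periodic point stays \<open>F\<close>-periodic when shrunk, and becomes \<open>T\<close>-periodic.
  Conversely every orbit descends: an aperiodic point of the unit square reaches the shrunk triangle
  under \<open>T\<close> (\<open>reaches_triangle\<close>), and a point of the triangle either lies in one of two pentagons, on
  which \<open>F\<close> is a rotation of order five, or has a point of the shrunk triangle nearby on its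
  \<open>F\<close>-orbit (\<open>pentagon_or_tower\<close>).

  For points over \<open>\<int>[\<gamma>]\<close> this descent ends, because of Galois conjugation \<open>\<gamma> \<mapsto> 1 - \<gamma>\<close>. Replacing a point
  by the nearby orbit point moves the conjugate by a rotation and a translation of length at most
  \<open>\<gamma>\<close>, and undoing \<open>shrink\<close> multiplies the conjugate by \<open>(1 - \<gamma>)\<^sup>2 = 1 / \<gamma>\<^sup>2\<close>, so a bound \<open>r\<close> becomes
  \<open>(r + \<gamma>) / \<gamma>\<^sup>2\<close>. The fixed value of this recursion is \<open>r = 1\<close>, and the only number in \<open>\<int>[\<gamma>] \<inter> [0, 1)\<close>
  with a conjugate in \<open>[- 6/5, 6/5]\<close> is \<open>0\<close>. As the triangle omits the origin, the descent can only
  end in a pentagon, that is, in a periodic point (\<open>F_periodic_conj_ball\<close>).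

  The exceptional point is mapped by \<open>T\<^sup>2\<close> to the shrunk image of \<open>(2/3, 0)\<close>. The \<open>F\<close>-orbit of \<open>(2/3, 0)\<close>
  contains a copy of \<open>(2/3, 0)\<close> shrunk four times; by self-similarity it contains copies that are
  arbitrarily small, so it is infinite (\<open>F_reaches_two_thirds\<close>, \<open>T_aperiodic\<close>).
\<close>

section \<open>Periodic points and induced maps\<close>

definition periodic :: "('a \<Rightarrow> 'a) \<Rightarrow> 'a \<Rightarrow> bool" where
  "periodic f z \<longleftrightarrow> (\<exists>p\<ge>1. (f ^^ p) z = z)"

lemma period_finite_iff: "period f z \<noteq> \<infinity> \<longleftrightarrow> periodic f z"
  by (auto simp: period_def periodic_def)

lemma funpow_mem:
  assumes "\<And>z. z \<in> S \<Longrightarrow> f z \<in> S" "z \<in> S"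
  shows "(f ^^ n) z \<in> S"
  using assms by (induction n) auto

lemma periodic_step_iff:
  assumes inj: "inj_on f S" and cl: "\<And>z. z \<in> S \<Longrightarrow> f z \<in> S" and z: "z \<in> S"
  shows "periodic f (f z) \<longleftrightarrow> periodic f z"
proof -
  have "(f ^^ p) (f z) = f z \<longleftrightarrow> (f ^^ p) z = z" for p
  proof -
    have "(f ^^ p) (f z) = f ((f ^^ p) z)"
      by (simp add: funpow_swap1)
    then show ?thesis
      using inj_onD[OF inj, of "(f ^^ p) z" z] funpow_mem[of S f z p, OF cl z] z by auto
  qed
  then show ?thesis
    by (simp add: periodic_def)
qed

lemma periodic_funpow_iff:
  assumes "inj_on f S" and cl: "\<And>z. z \<in> S \<Longrightarrow> f z \<in> S" and "z \<in> S"
  shows "periodic f ((f ^^ n) z) \<longleftrightarrow> periodic f z"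
proof (induction n)
  case (Suc n)
  then show ?case
    using periodic_step_iff[of f S "(f ^^ n) z"] funpow_mem[of S f z n] assms by simp
qed simp

text \<open>
  The times \<open>k\<close> may depend on the point, so that \<open>F\<close> can be a copy of a return map of \<open>f\<close>. The bound
  \<open>k \<ge> n\<close> keeps the time positive when a period of \<open>F\<close> is turned into one of \<open>f\<close>.
\<close>

lemma funpow_induced:
  assumes ind: "\<And>z. z \<in> S \<Longrightarrow> \<exists>k\<ge>1. (f ^^ k) (h z) = h (F z)"
    and cl: "\<And>z. z \<in> S \<Longrightarrow> F z \<in> S" and z: "z \<in> S"
  shows "\<exists>k\<ge>n. (f ^^ k) (h z) = h ((F ^^ n) z)"
proof (induction n)
  case (Suc n)
  then obtain k where k: "k \<ge> n" "(f ^^ k) (h z) = h ((F ^^ n) z)"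
    by blast
  obtain l where l: "l \<ge> 1" "(f ^^ l) (h ((F ^^ n) z)) = h (F ((F ^^ n) z))"
    using ind[OF funpow_mem[of S F z n, OF cl z]] by blast
  have "(f ^^ (l + k)) (h z) = h ((F ^^ Suc n) z)"
    using k l by (simp add: funpow_add)
  moreover have "l + k \<ge> Suc n"
    using k l by simp
  ultimately show ?case
    by blast
qed (auto intro: exI[of _ 0])

lemma periodic_induced:
  assumes "\<And>z. z \<in> S \<Longrightarrow> \<exists>k\<ge>1. (f ^^ k) (h z) = h (F z)"
    and "\<And>z. z \<in> S \<Longrightarrow> F z \<in> S" and "z \<in> S" and "periodic F z"
  shows "periodic f (h z)"
proof -
  obtain p where p: "p \<ge> 1" "(F ^^ p) z = z"
    using assms(4) by (auto simp: periodic_def)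
  obtain k where "k \<ge> p" "(f ^^ k) (h z) = h ((F ^^ p) z)"
    using funpow_induced[of S f h F z p, OF assms(1-3)] by blast
  with p show ?thesis
    by (auto simp: periodic_def intro!: exI[of _ k])
qed

lemma periodic_finite_orbit:
  assumes "periodic f z"
  shows "finite (range (\<lambda>n. (f ^^ n) z))"
proof -
  obtain p where p: "p \<ge> 1" "(f ^^ p) z = z"
    using assms by (auto simp: periodic_def)
  have "(f ^^ n) z \<in> (\<lambda>n. (f ^^ n) z) ` {..<p}" for n
  proof -
    have "(f ^^ n) z = (f ^^ (n mod p)) z"
      using funpow_mod_eq[OF p(2), of n] by simp
    then show ?thesis
      using p(1) by auto
  qed
  then have "range (\<lambda>n. (f ^^ n) z) \<subseteq> (\<lambda>n. (f ^^ n) z) ` {..<p}"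
    by auto
  then show ?thesis
    by (rule finite_subset) simp
qed

section \<open>Arithmetic of the golden mean\<close>

lemma golden_sq: "golden * golden = golden + 1"
  by (simp add: golden_def field_simps)

lemma golden_sq_mult: "golden * (golden * x) = golden * x + x"
  using golden_sq by (simp add: distrib_right flip: mult.assoc)

lemma golden_bounds: "809 / 500 < golden" "golden < 1619 / 1000"
proof -
  have "559 / 250 < sqrt 5"
    by (rule real_less_rsqrt) (simp add: power2_eq_square)
  moreover have "sqrt 5 < 1119 / 500"
    by (rule real_less_lsqrt) (simp_all add: power2_eq_square)
  ultimately show "809 / 500 < golden" "golden < 1619 / 1000"
    by (auto simp: golden_def)
qed

lemma golden_pos: "golden > 0"
  using golden_bounds by simp

lemmas golden_simps = algebra_simps golden_sq golden_sq_mult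

section \<open>A self-similar piecewise rotation of a triangle\<close>

text \<open>
  An isosceles triangle with angles 36, 72, 72 degrees in the coordinates that make the linear part
  of \<open>T\<close> a rotation. The origin is omitted because its image \<open>(1, 0)\<close> under the formula for \<open>F\<close> lies
  outside.
\<close>

definition golden_triangle :: "(real \<times> real) set" where
  "golden_triangle = {(x, y). 0 \<le> x \<and> 0 \<le> y \<and> 0 < x + y \<and> x + y < 1}"

text \<open>
  With the rotation \<open>A (x, y) = (y, - x - \<gamma> y)\<close>, the linear parts of the two branches are \<open>A\<^sup>-\<^sup>1\<close> and \<open>A\<close>.
  In the coordinates in which \<open>A\<close> is a rotation, the line \<open>\<gamma> x + y = 1\<close> between them bisects the angle
  of the triangle at \<open>(0, 1)\<close>.
\<close>

definition F :: "real \<times> real \<Rightarrow> real \<times> real" where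
  "F = (\<lambda>(x, y). if golden * x + y \<le> 1 then (1 - golden * x - y, x)
                 else (y, golden - x - golden * y))"

definition shrink :: "real \<times> real \<Rightarrow> real \<times> real" where
  "shrink = (\<lambda>(x, y). ((2 - golden) * x, (2 - golden) * y))"

lemma shrink_image_iff:
  "(p, q) \<in> shrink ` golden_triangle \<longleftrightarrow> 0 \<le> p \<and> 0 \<le> q \<and> 0 < p + q \<and> p + q < 2 - golden"
    (is "?L \<longleftrightarrow> ?R")
proof
  have pos: "2 - golden > 0"
    using golden_bounds by simp
  show ?R if L: ?L
  proof -
    obtain w where w: "w \<in> golden_triangle" "(p, q) = shrink w"
      using L by blast
    obtain x y where "w = (x, y)"
      by (cases w)
    with w have xy: "(x, y) \<in> golden_triangle" "p = (2 - golden) * x" "q = (2 - golden) * y"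
      by (simp_all add: shrink_def)
    have "p + q = (2 - golden) * (x + y)"
      by (simp add: xy algebra_simps)
    moreover have "(2 - golden) * (x + y) < (2 - golden) * 1" "0 < (2 - golden) * (x + y)"
      using xy(1) pos by (auto simp: golden_triangle_def intro!: mult_strict_left_mono)
    ultimately show ?thesis
      using xy pos by (auto simp: golden_triangle_def)
  qed
  show ?L if R: ?R
  proof
    have "(golden + 1) * (p + q) < (golden + 1) * (2 - golden)" "0 < (golden + 1) * (p + q)"
      using R golden_pos by (auto intro!: mult_strict_left_mono)
    then show "((golden + 1) * p, (golden + 1) * q) \<in> golden_triangle"
      using R golden_pos by (auto simp: golden_triangle_def golden_simps)
    show "(p, q) = shrink ((golden + 1) * p, (golden + 1) * q)"
      by (simp add: shrink_def golden_simps)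
  qed
qed

lemma F_triangle:
  assumes "z \<in> golden_triangle"
  shows "F z \<in> golden_triangle"
proof -
  obtain x y where z: "z = (x, y)"
    by (cases z)
  have xy: "0 \<le> x" "0 \<le> y" "0 < x + y" "x + y < 1"
    using assms by (auto simp: golden_triangle_def z)
  show ?thesis
  proof (cases "golden * x + y \<le> 1")
    case True
    have "(golden - 1) * x + y > 0"
      using xy golden_bounds by (cases "x = 0") (auto intro!: add_pos_nonneg)
    moreover have "1 - golden * x - y + x > 0"
    proof (cases "x = 0")
      case False
      with True xy show ?thesis by linarith
    qed (use xy in simp)
    ultimately show ?thesis
      using xy True by (simp add: F_def z golden_triangle_def algebra_simps)
  next
    case False
    have "golden * (x + y) < golden * 1"
      using xy golden_pos by (intro mult_strict_left_mono) auto
    moreover have "(golden - 1) * (golden * x + y) > (golden - 1) * 1"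
      using False golden_bounds by (intro mult_strict_left_mono) auto
    moreover have "(golden - 1) * x \<ge> 0"
      using xy golden_bounds by simp
    ultimately show ?thesis
      using xy False by (simp add: F_def z golden_triangle_def golden_simps)
  qed
qed

text \<open>
  The images of the two halves are separated by the line \<open>x + \<gamma> y = 1\<close>.
\<close>

lemma F_inj: "inj_on F golden_triangle"
proof (rule inj_onI)
  fix z w assume zw: "z \<in> golden_triangle" "w \<in> golden_triangle" "F z = F w"
  obtain x y where z: "z = (x, y)" by (cases z)
  obtain x' y' where w: "w = (x', y')" by (cases w)
  have side: "fst (F (x, y)) + golden * snd (F (x, y)) \<le> 1 \<longleftrightarrow> golden * x + y \<le> 1"
    if "(x, y) \<in> golden_triangle" for x y
  proof -
    have "golden * (x + y) < golden * 1"
      using that golden_pos by (intro mult_strict_left_mono) (auto simp: golden_triangle_def)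
    then show ?thesis
      using that by (auto simp: F_def golden_triangle_def golden_simps)
  qed
  have "golden * x + y \<le> 1 \<longleftrightarrow> golden * x' + y' \<le> 1"
    using side[of x y] side[of x' y'] zw by (simp add: z w)
  then show "z = w"
    using zw(3) by (auto simp: z w F_def split: if_splits)
qed

text \<open>
  Under \<open>shrink\<close>, the line between the two halves becomes \<open>\<gamma> p + q = 2 - \<gamma>\<close>, and the constants \<open>1\<close> and \<open>\<gamma>\<close>
  in the branches of \<open>F\<close> become \<open>2 - \<gamma>\<close> and \<open>(2 - \<gamma>) \<gamma> = \<gamma> - 1\<close>. The three bounds with a factor \<open>\<gamma>\<close> on
  \<open>p\<close>, \<open>q\<close> or \<open>p + q\<close> make the floor computations for \<open>F\<close> and \<open>T\<close> a matter of linear arithmetic.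
\<close>

lemma golden_triangle_shrinkE:
  assumes "z \<in> golden_triangle"
  obtains p q where "shrink z = (p, q)"
    "0 \<le> p" "0 \<le> q" "0 < p + q" "p + q < 2 - golden"
    "golden * (p + q) < golden * (2 - golden)" "p \<le> golden * p" "q \<le> golden * q"
    "shrink (F z) = (if golden * p + q \<le> 2 - golden then (2 - golden - golden * p - q, p)
      else (q, golden - 1 - p - golden * q))"
proof -
  obtain x y where z: "z = (x, y)"
    by (cases z)
  define p q where "p = (2 - golden) * x" and "q = (2 - golden) * y"
  have zs: "shrink z = (p, q)"
    by (simp add: z shrink_def p_def q_def)
  have pq: "0 \<le> p" "0 \<le> q" "0 < p + q" "p + q < 2 - golden"
    using shrink_image_iff[of p q] assms zs by (metis imageI)+
  have gpq: "golden * (p + q) < golden * (2 - golden)" "p \<le> golden * p" "q \<le> golden * q"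
    using pq golden_bounds by (auto intro!: mult_strict_left_mono simp: mult_le_cancel_right1)
  have "golden * p + q = (2 - golden) * (golden * x + y)"
    by (simp add: p_def q_def algebra_simps)
  then have side: "golden * p + q \<le> 2 - golden \<longleftrightarrow> golden * x + y \<le> 1"
    using golden_bounds mult_le_cancel_left_pos[of "2 - golden" "golden * x + y" 1] by simp
  have "shrink (F z) = (if golden * p + q \<le> 2 - golden then (2 - golden - golden * p - q, p)
      else (q, golden - 1 - p - golden * q))"
    using side by (simp add: z F_def shrink_def p_def q_def golden_simps)
  then show ?thesis
    using that zs pq gpq by simp
qed

text \<open>
  Self-similarity. A point of the shrunk triangle returns after visiting the left and right halves
  in the order left, right, left, or left, right, right, right, left.
\<close>

lemma F_induced:
  assumes "z \<in> golden_triangle"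
  shows "\<exists>k\<ge>1. (F ^^ k) (shrink z) = shrink (F z)"
proof -
  obtain p q where zs: "shrink z = (p, q)"
    and pq: "0 \<le> p" "0 \<le> q" "0 < p + q" "p + q < 2 - golden"
      "golden * (p + q) < golden * (2 - golden)" "p \<le> golden * p" "q \<le> golden * q"
    and ret: "shrink (F z) = (if golden * p + q \<le> 2 - golden then (2 - golden - golden * p - q, p)
      else (q, golden - 1 - p - golden * q))"
    using assms by (rule golden_triangle_shrinkE)
  have 1: "F (p, q) = (1 - golden * p - q, p)"
    using pq golden_bounds by (simp add: F_def golden_simps)
  have 2: "F (1 - golden * p - q, p) = (p, q + golden - 1)"
    using pq golden_bounds by (simp add: F_def golden_simps)
  show ?thesis
  proof (cases "golden * p + q \<le> 2 - golden")
    case True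
    have 3: "F (p, q + golden - 1) = (2 - golden - golden * p - q, p)"
      using True by (simp add: F_def golden_simps)
    have "(F ^^ 3) (shrink z) = shrink (F z)"
      using True by (simp add: numeral_eq_Suc ret zs 1 2 3)
    then show ?thesis
      by (intro exI[of _ 3]) simp
  next
    case False
    have 3: "F (p, q + golden - 1) = (q + golden - 1, golden - 1 - p - golden * q)"
      using False by (simp add: F_def golden_simps)
    have 4: "F (q + golden - 1, golden - 1 - p - golden * q) =
        (golden - 1 - p - golden * q, golden * p + golden * q)"
      using pq golden_bounds by (simp add: F_def golden_simps)
    have 5: "F (golden - 1 - p - golden * q, golden * p + golden * q) =
        (q, golden - 1 - p - golden * q)"
      using pq by (simp add: F_def golden_simps)
    have "(F ^^ 5) (shrink z) = shrink (F z)"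
      using False by (simp add: numeral_eq_Suc ret zs 1 2 3 4 5)
    then show ?thesis
      by (intro exI[of _ 5]) simp
  qed
qed

section \<open>The return map of T to the shrunk triangle\<close>

lemma T_eqI:
  assumes "n \<in> \<int>" "0 \<le> n - x - golden * y" "n - x - golden * y < 1"
  shows "T (x, y) = (y, n - x - golden * y)"
proof -
  have "frac (- x - golden * y) = n - x - golden * y"
    using assms by (subst frac_unique_iff) simp
  then show ?thesis
    by (simp add: T_def)
qed

text \<open>
  A point of the shrunk triangle returns after four or six steps of \<open>T\<close>; the integers added to bring
  \<open>- x - \<gamma> y\<close> back to \<open>[0, 1)\<close> are \<open>1, 2, 2, 1\<close> over the left half and \<open>1, 2, 3, 3, 2, 1\<close> over the right
  half. The origin has to be excluded, as \<open>T\<close> fixes it.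
\<close>

lemma T_induced:
  assumes "z \<in> golden_triangle"
  shows "\<exists>k\<ge>1. (T ^^ k) (shrink z) = shrink (F z)"
proof -
  obtain p q where zs: "shrink z = (p, q)"
    and pq: "0 \<le> p" "0 \<le> q" "0 < p + q" "p + q < 2 - golden"
      "golden * (p + q) < golden * (2 - golden)" "p \<le> golden * p" "q \<le> golden * q"
    and ret: "shrink (F z) = (if golden * p + q \<le> 2 - golden then (2 - golden - golden * p - q, p)
      else (q, golden - 1 - p - golden * q))"
    using assms by (rule golden_triangle_shrinkE)
  have 1: "T (p, q) = (q, 1 - p - golden * q)"
    using pq golden_bounds by (intro T_eqI) (auto simp: golden_simps)
  have 2: "T (q, 1 - p - golden * q) = (1 - p - golden * q, 2 - golden + golden * p + golden * q)"
    using T_eqI[of 2 q "1 - p - golden * q"] pq golden_bounds by (simp add: golden_simps)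
  show ?thesis
  proof (cases "golden * p + q \<le> 2 - golden")
    case True
    have 3: "T (1 - p - golden * q, 2 - golden + golden * p + golden * q) =
        (2 - golden + golden * p + golden * q, 2 - golden - golden * p - q)"
      using T_eqI[of 2 "1 - p - golden * q" "2 - golden + golden * p + golden * q"]
        pq golden_bounds True by (simp add: golden_simps)
    have 4: "T (2 - golden + golden * p + golden * q, 2 - golden - golden * p - q) =
        (2 - golden - golden * p - q, p)"
      using T_eqI[of 1 "2 - golden + golden * p + golden * q" "2 - golden - golden * p - q"]
        pq golden_bounds by (simp add: golden_simps)
    have "(T ^^ 4) (shrink z) = shrink (F z)"
      using True by (simp add: numeral_eq_Suc ret zs 1 2 3 4)
    then show ?thesis
      by (intro exI[of _ 4]) simp
  next
    case False
    have 3: "T (1 - p - golden * q, 2 - golden + golden * p + golden * q) =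
        (2 - golden + golden * p + golden * q, 3 - golden - golden * p - q)"
      using T_eqI[of 3 "1 - p - golden * q" "2 - golden + golden * p + golden * q"]
        pq golden_bounds False by (simp add: golden_simps)
    have 4: "T (2 - golden + golden * p + golden * q, 3 - golden - golden * p - q) =
        (3 - golden - golden * p - q, 2 - golden + p)"
      using T_eqI[of 3 "2 - golden + golden * p + golden * q" "3 - golden - golden * p - q"]
        pq golden_bounds by (simp add: golden_simps)
    have 5: "T (3 - golden - golden * p - q, 2 - golden + p) = (2 - golden + p, q)"
      using T_eqI[of 2 "3 - golden - golden * p - q" "2 - golden + p"]
        pq golden_bounds by (simp add: golden_simps)
    have 6: "T (2 - golden + p, q) = (q, golden - 1 - p - golden * q)"
      using T_eqI[of 1 "2 - golden + p" q]
        pq golden_bounds by (simp add: golden_simps)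
    have "(T ^^ 6) (shrink z) = shrink (F z)"
      using False by (simp add: numeral_eq_Suc ret zs 1 2 3 4 5 6)
    then show ?thesis
      by (intro exI[of _ 6]) simp
  qed
qed

section \<open>Pentagons of period five and the towers over the shrunk triangle\<close>

lemma F_left: "golden * x + y \<le> 1 \<Longrightarrow> F (x, y) = (1 - golden * x - y, x)"
  by (simp add: F_def)

lemma F_right: "golden * x + y > 1 \<Longrightarrow> F (x, y) = (y, golden - x - golden * y)"
  by (simp add: F_def)

text \<open>
  The five defining inequalities are permuted by the left branch, so the orbit stays in the left
  half for five steps, and five rotations by the same multiple of 72 degrees about a common centre
  compose to the identity.
\<close>

lemma F_left_pentagon:
  assumes "0 \<le> x" "0 \<le> y" "golden * x + y \<le> 1" "x + golden * y \<le> 1" "2 - golden \<le> x + y"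
  shows "(F ^^ 5) (x, y) = (x, y)"
proof -
  have "golden * (2 - golden) \<le> golden * (x + y)"
    using assms golden_pos by (intro mult_left_mono) auto
  then have 2: "F (1 - golden * x - y, x) = (1 - golden + golden * x + golden * y, 1 - golden * x - y)"
    by (subst F_left) (simp_all add: golden_simps)
  have 1: "F (x, y) = (1 - golden * x - y, x)"
    using assms by (simp add: F_left)
  have 3: "F (1 - golden + golden * x + golden * y, 1 - golden * x - y) =
      (1 - x - golden * y, 1 - golden + golden * x + golden * y)"
    using assms by (subst F_left) (simp_all add: golden_simps)
  have 4: "F (1 - x - golden * y, 1 - golden + golden * x + golden * y) = (y, 1 - x - golden * y)"
    using assms by (subst F_left) (simp_all add: golden_simps)
  have 5: "F (y, 1 - x - golden * y) = (x, y)"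
    using assms by (subst F_left) (simp_all add: golden_simps)
  show ?thesis
    by (simp add: numeral_eq_Suc 1 2 3 4 5)
qed

text \<open>
  The same argument with the right branch.
\<close>

lemma F_right_pentagon:
  assumes "x < golden - 1" "y < golden - 1" "golden * x + y > 1" "x + golden * y > 1" "x + y < 1"
  shows "(F ^^ 5) (x, y) = (x, y)"
proof -
  have "golden * (x + y) < golden * 1"
    using assms golden_pos by (intro mult_strict_left_mono) auto
  then have 5: "F (golden - golden * x - y, x) = (x, y)"
    by (subst F_right) (simp_all add: golden_simps)
  have 1: "F (x, y) = (y, golden - x - golden * y)"
    using assms by (simp add: F_right)
  have 2: "F (y, golden - x - golden * y) = (golden - x - golden * y, golden * x + golden * y - 1)"
    using assms by (subst F_right) (simp_all add: golden_simps)
  have 3: "F (golden - x - golden * y, golden * x + golden * y - 1) =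
      (golden * x + golden * y - 1, golden - golden * x - y)"
    using assms by (subst F_right) (simp_all add: golden_simps)
  have 4: "F (golden * x + golden * y - 1, golden - golden * x - y) = (golden - golden * x - y, x)"
    using assms by (subst F_right) (simp_all add: golden_simps)
  show ?thesis
    by (simp add: numeral_eq_Suc 1 2 3 4 5)
qed

lemma shrink_image_subset: "shrink ` golden_triangle \<subseteq> golden_triangle"
proof
  fix z assume z: "z \<in> shrink ` golden_triangle"
  obtain p q where "z = (p, q)"
    by (cases z)
  with z have "0 \<le> p \<and> 0 \<le> q \<and> 0 < p + q \<and> p + q < 2 - golden"
    by (simp only: shrink_image_iff)
  with \<open>z = (p, q)\<close> show "z \<in> golden_triangle"
    using golden_bounds by (simp add: golden_triangle_def)
qed

lemmas F_periodic_funpow_iff = periodic_funpow_iff[of F golden_triangle, OF F_inj F_triangle]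

text \<open>
  Outside the two pentagons the triangle is filled by the towers over the two halves of the shrunk
  triangle, that is, by the iterates of these halves before they return. Every floor of a tower can
  be joined to the base within two steps of \<open>F\<close>, forwards or backwards; this gives the five candidates for
  \<open>p\<close>. Each candidate is a power of the rotation applied to \<open>(x, y)\<close>, followed by a translation;
  the choice of direction keeps the conjugates of these translations short (see \<open>conj_ball_near\<close>).
\<close>

lemma pentagon_or_tower:
  assumes xy: "(x, y) \<in> golden_triangle"
  shows "(F ^^ 5) (x, y) = (x, y) \<or>
    (\<exists>p \<in> shrink ` golden_triangle.
       p \<in> {(x, y), (y, 1 - x - golden * y), (x, y - (golden - 1)),
            (x - (golden - 1), y), (1 - golden * x - y, x)} \<and>
       (periodic F p \<longrightarrow> periodic F (x, y)))"
    (is "?pent \<or> (\<exists>p \<in> _. p \<in> ?near \<and> _)")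
proof -
  have b: "0 \<le> x" "0 \<le> y" "0 < x + y" "x + y < 1"
    using xy by (auto simp: golden_triangle_def)
  have gb: "golden * x \<ge> x" "golden * y \<ge> y" "golden * (x + y) < golden * 1"
      "golden * x \<le> 2 * x" "golden * y \<le> 2 * y"
    using b golden_bounds by (auto simp: mult_le_cancel_right1 intro!: mult_right_mono)
  have tower: ?thesis
    if "p \<in> shrink ` golden_triangle" "p \<in> ?near" "(F ^^ m) p = (F ^^ n) (x, y)" for p m n
  proof -
    have "p \<in> golden_triangle"
      using that(1) shrink_image_subset by blast
    then have "periodic F p \<longrightarrow> periodic F (x, y)"
      using F_periodic_funpow_iff[of p m] F_periodic_funpow_iff[of "(x, y)" n] xy that(3) by simp
    with that show ?thesis
      by blast
  qed
  (* base: the shrunk triangle. after, before: one step of F after or before it.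
     top, side: two steps after or before it. left, right: the pentagons. *)
  consider (base) "x + y < 2 - golden"
    | (left) "2 - golden \<le> x + y" "golden * x + y \<le> 1" "x + golden * y \<le> 1"
    | (after) "golden * x + y > 1" "x + golden * y \<le> 1"
    | (before) "golden * x + y \<le> 1" "x + golden * y > 1"
    | (top) "golden * x + y > 1" "x + golden * y > 1" "y \<ge> golden - 1"
    | (side) "golden * x + y > 1" "x + golden * y > 1" "x \<ge> golden - 1"
    | (right) "golden * x + y > 1" "x + golden * y > 1" "y < golden - 1" "x < golden - 1"
    by linarith
  then show ?thesis
  proof cases
    case base
    then show ?thesis
      using b by (intro tower[of "(x, y)" 0 0]) (auto simp: shrink_image_iff)
  next
    case left
    then show ?thesis
      using b by (auto intro: F_left_pentagon)
  next
    case after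
    have "(golden - 1) * (golden * x + y) > (golden - 1) * 1"
      using after golden_bounds by (intro mult_strict_left_mono) auto
    then show ?thesis
      using b after gb by (intro tower[of "(y, 1 - x - golden * y)" 1 0])
        (auto simp: shrink_image_iff F_left golden_simps)
  next
    case before
    have "(golden - 1) * (x + golden * y) > (golden - 1) * 1"
      using before golden_bounds by (intro mult_strict_left_mono) auto
    then show ?thesis
      using b before gb by (intro tower[of "(1 - golden * x - y, x)" 0 1])
        (auto simp: shrink_image_iff F_left golden_simps)
  next
    case top
    have 1: "F (x, y - (golden - 1)) = (golden - golden * x - y, x)"
      using gb b by (subst F_left) (auto simp: golden_simps)
    have 2: "F (golden - golden * x - y, x) = (x, y)"
      using gb b by (subst F_right) (auto simp: golden_simps)
    have "0 < x + (y - (golden - 1))"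
      using top b golden_bounds by (cases "x = 0") auto
    then show ?thesis
      using b top by (intro tower[of "(x, y - (golden - 1))" 2 0])
        (auto simp: shrink_image_iff numeral_eq_Suc 1 2)
  next
    case side
    have 1: "F (x, y) = (y, golden - x - golden * y)"
      using side by (simp add: F_right)
    have 2: "F (y, golden - x - golden * y) = (x - (golden - 1), y)"
      using side by (subst F_left) (auto simp: golden_simps)
    have "0 < (x - (golden - 1)) + y"
      using side b golden_bounds by (cases "y = 0") auto
    then show ?thesis
      using b side by (intro tower[of "(x - (golden - 1), y)" 0 2])
        (auto simp: shrink_image_iff numeral_eq_Suc 1 2)
  next
    case right
    then show ?thesis
      using b by (auto intro: F_right_pentagon)
  qed
qed

section \<open>Contraction of Galois conjugates\<close>

text \<open>
  Galois conjugation of \<open>\<int>[\<gamma>]\<close>, as a relation so that it also records the membership \<open>x \<in> \<int>[\<gamma>]\<close>.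
\<close>

definition conjugates :: "real \<Rightarrow> real \<Rightarrow> bool" where
  "conjugates x u \<longleftrightarrow>
     (\<exists>a b :: int. x = of_int a + of_int b * golden \<and> u = of_int a + of_int b * (1 - golden))"

lemma conjugates_of_int: "conjugates (of_int n) (of_int n)"
  unfolding conjugates_def by (rule exI[of _ n], rule exI[of _ 0]) simp

lemma conjugates_add:
  assumes "conjugates x u" "conjugates y v"
  shows "conjugates (x + y) (u + v)"
proof -
  obtain a b c d :: int where
    "x = of_int a + of_int b * golden" "u = of_int a + of_int b * (1 - golden)"
    "y = of_int c + of_int d * golden" "v = of_int c + of_int d * (1 - golden)"
    using assms by (auto simp: conjugates_def)
  then have "x + y = of_int (a + c) + of_int (b + d) * golden"
    "u + v = of_int (a + c) + of_int (b + d) * (1 - golden)"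
    by (simp_all add: algebra_simps)
  then show ?thesis
    unfolding conjugates_def by blast
qed

lemma conjugates_golden_mult:
  assumes "conjugates x u"
  shows "conjugates (golden * x) ((1 - golden) * u)"
proof -
  obtain a b :: int where
    xu: "x = of_int a + of_int b * golden" "u = of_int a + of_int b * (1 - golden)"
    using assms by (auto simp: conjugates_def)
  have "golden * x = of_int b + of_int (a + b) * golden"
    "(1 - golden) * u = of_int b + of_int (a + b) * (1 - golden)"
    unfolding xu by (simp_all add: golden_simps)
  then show ?thesis
    unfolding conjugates_def by blast
qed

lemma conjugates_uminus:
  assumes "conjugates x u"
  shows "conjugates (- x) (- u)"
proof -
  obtain a b :: int where
    "x = of_int a + of_int b * golden" "u = of_int a + of_int b * (1 - golden)"
    using assms by (auto simp: conjugates_def)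
  then have "- x = of_int (- a) + of_int (- b) * golden"
    "- u = of_int (- a) + of_int (- b) * (1 - golden)"
    by (simp_all add: algebra_simps)
  then show ?thesis
    unfolding conjugates_def by blast
qed

lemma conjugates_diff: "conjugates x u \<Longrightarrow> conjugates y v \<Longrightarrow> conjugates (x - y) (u - v)"
  using conjugates_add[of x u "- y" "- v"] conjugates_uminus by simp

lemmas conjugates_intros = conjugates_add conjugates_diff conjugates_golden_mult

lemma conjugates_1: "conjugates 1 1"
  using conjugates_of_int[of 1] by simp

lemma conjugates_golden: "conjugates golden (1 - golden)"
  using conjugates_golden_mult[OF conjugates_1] by simp

lemma Z_golden_conjugates:
  assumes "x \<in> Z_golden"
  shows "\<exists>u. conjugates x u"
proof -
  obtain p :: "int poly" where "x = poly (map_poly of_int p) golden"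
    using assms by (auto simp: Z_golden_def)
  moreover have "\<exists>u. conjugates (poly (map_poly of_int p) golden) u"
  proof (induction p)
    case 0
    then show ?case
      using conjugates_of_int[of 0] by auto
  next
    case (pCons a p)
    then show ?case
      using conjugates_add[OF conjugates_of_int[of a] conjugates_golden_mult]
      by (auto simp: map_poly_pCons)
  qed
  ultimately show ?thesis
    by simp
qed

text \<open>
  A number \<open>a + b \<gamma>\<close> differs from its conjugate by \<open>b \<surd>5\<close>, and \<open>\<surd>5 > 1 + 6 / 5\<close> forces \<open>b = 0\<close>. The constant
  \<open>6 / 5\<close> leaves some room above the limiting bound \<open>1\<close> of the descent.
\<close>

lemma conjugates_small_imp_0:
  assumes "conjugates x u" "0 \<le> x" "x < 1" "\<bar>u\<bar> \<le> 6 / 5"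
  shows "x = 0"
proof -
  obtain a b :: int where ab: "x = of_int a + of_int b * golden" "u = of_int a + of_int b * (1 - golden)"
    using assms(1) by (auto simp: conjugates_def)
  have "b = 0"
  proof (rule ccontr)
    assume "b \<noteq> 0"
    have "(2 * golden - 1) * 1 \<le> (2 * golden - 1) * of_int \<bar>b\<bar>"
      using \<open>b \<noteq> 0\<close> golden_bounds by (intro mult_left_mono) auto
    also have "\<dots> = \<bar>(2 * golden - 1) * of_int b\<bar>"
      using golden_bounds by (simp add: abs_mult)
    also have "(2 * golden - 1) * of_int b = x - u"
      by (simp add: ab algebra_simps)
    finally have "(2 * golden - 1) * 1 \<le> x + \<bar>u\<bar>"
      using abs_triangle_ineq4[of x u] assms by simp
    then show False
      using assms(3,4) golden_bounds(1) by simp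
  qed
  then show ?thesis
    using ab assms by auto
qed

text \<open>
  A ball in a decagonal norm of the conjugate point. Up to sign the five linear forms are the images of
  the first coordinate under the conjugate rotation \<open>(u, v) \<mapsto> (v, - u - (1 - \<gamma>) v)\<close>, so this norm is
  invariant under the linear parts of \<open>F\<close> and \<open>T\<close>, and its use keeps all estimates linear.
\<close>

definition conj_ball :: "real \<Rightarrow> real \<times> real \<Rightarrow> bool" where
  "conj_ball r z \<longleftrightarrow> (\<exists>u v. conjugates (fst z) u \<and> conjugates (snd z) v \<and>
     \<bar>u\<bar> \<le> r \<and> \<bar>v\<bar> \<le> r \<and> \<bar>u + (1 - golden) * v\<bar> \<le> r \<and> \<bar>(1 - golden) * u + v\<bar> \<le> r \<and>
     \<bar>(1 - golden) * (u + v)\<bar> \<le> r)"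

lemma conj_ball_mono: "conj_ball r z \<Longrightarrow> r \<le> s \<Longrightarrow> conj_ball s z"
  unfolding conj_ball_def by (meson order_trans)

lemma conj_ball_exists:
  assumes "conjugates (fst z) u" "conjugates (snd z) v"
  shows "\<exists>r. conj_ball r z"
proof -
  let ?r = "\<bar>u\<bar> + \<bar>v\<bar> + \<bar>(1 - golden) * u\<bar> + \<bar>(1 - golden) * v\<bar>"
  have "\<bar>u + (1 - golden) * v\<bar> \<le> ?r" "\<bar>(1 - golden) * u + v\<bar> \<le> ?r"
    by linarith+
  moreover have "\<bar>(1 - golden) * (u + v)\<bar> \<le> ?r"
    unfolding distrib_left by linarith
  moreover have "\<bar>u\<bar> \<le> ?r" "\<bar>v\<bar> \<le> ?r"
    by linarith+
  ultimately show ?thesis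
    using assms unfolding conj_ball_def by blast
qed

text \<open>
  Each candidate of \<open>pentagon_or_tower\<close> arises by a rotation, which preserves the norm, and a
  translation by \<open>0\<close>, a unit vector, or \<open>1 / \<gamma> = \<gamma> - 1\<close> times a unit vector. The conjugate of \<open>\<gamma> - 1\<close> is
  \<open>- \<gamma>\<close>, so the norm grows by at most \<open>\<gamma>\<close>.
\<close>

lemma conj_ball_near:
  assumes "conj_ball r (x, y)"
    and "p \<in> {(x, y), (y, 1 - x - golden * y), (x, y - (golden - 1)),
            (x - (golden - 1), y), (1 - golden * x - y, x)}"
  shows "conj_ball (r + golden) p"
proof -
  obtain u v where c: "conjugates x u" "conjugates y v"
    and b: "\<bar>u\<bar> \<le> r" "\<bar>v\<bar> \<le> r" "\<bar>u + (1 - golden) * v\<bar> \<le> r" "\<bar>(1 - golden) * u + v\<bar> \<le> r"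
      "\<bar>(1 - golden) * (u + v)\<bar> \<le> r"
    using assms(1) by (auto simp: conj_ball_def)
  have lin: "u \<le> r" "- u \<le> r" "v \<le> r" "- v \<le> r"
      "u + v - golden * v \<le> r" "golden * v - u - v \<le> r"
      "u - golden * u + v \<le> r" "golden * u - u - v \<le> r"
      "u + v - golden * u - golden * v \<le> r" "golden * u + golden * v - u - v \<le> r"
    using b[unfolded abs_le_iff] by (simp_all add: algebra_simps)
  have mem: "conj_ball (r + golden) (x', y')"
    if "conjugates x' u'" "conjugates y' v'"
      "\<bar>u'\<bar> \<le> r + golden" "\<bar>v'\<bar> \<le> r + golden" "\<bar>u' + (1 - golden) * v'\<bar> \<le> r + golden"
      "\<bar>(1 - golden) * u' + v'\<bar> \<le> r + golden" "\<bar>(1 - golden) * (u' + v')\<bar> \<le> r + golden"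
    for x' y' u' v'
    using that unfolding conj_ball_def by auto
  consider "p = (x, y)" | "p = (y, 1 - x - golden * y)" | "p = (x, y - (golden - 1))"
    | "p = (x - (golden - 1), y)" | "p = (1 - golden * x - y, x)"
    using assms(2) by auto
  then show ?thesis
  proof cases
    case 1
    show ?thesis
      unfolding 1 using lin golden_pos by (intro mem[OF c] abs_leI; simp add: golden_simps)
  next
    case 2
    have *: "conjugates (1 - x - golden * y) (1 - u - (1 - golden) * v)"
      by (intro conjugates_intros conjugates_1 c)
    show ?thesis
      unfolding 2 using lin golden_bounds by (intro mem[OF c(2) *] abs_leI; simp add: golden_simps)
  next
    case 3
    have *: "conjugates (y - (golden - 1)) (v - ((1 - golden) - 1))"
      by (intro conjugates_intros conjugates_1 conjugates_golden c)
    show ?thesis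
      unfolding 3 using lin golden_bounds by (intro mem[OF c(1) *] abs_leI; simp add: golden_simps)
  next
    case 4
    have *: "conjugates (x - (golden - 1)) (u - ((1 - golden) - 1))"
      by (intro conjugates_intros conjugates_1 conjugates_golden c)
    show ?thesis
      unfolding 4 using lin golden_bounds by (intro mem[OF * c(2)] abs_leI; simp add: golden_simps)
  next
    case 5
    have *: "conjugates (1 - golden * x - y) (1 - (1 - golden) * u - v)"
      by (intro conjugates_intros conjugates_1 c)
    show ?thesis
      unfolding 5 using lin golden_bounds by (intro mem[OF * c(1)] abs_leI; simp add: golden_simps)
  qed
qed

text \<open>
  Undoing \<open>shrink\<close> is multiplication by \<open>\<gamma>\<^sup>2\<close>, whose conjugate \<open>(1 - \<gamma>)\<^sup>2 = 2 - \<gamma>\<close> is less than \<open>1\<close>.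
\<close>

lemma conj_ball_shrink:
  assumes "conj_ball r (shrink z)"
  shows "conj_ball ((2 - golden) * r) z"
proof -
  obtain u v where c: "conjugates (fst (shrink z)) u" "conjugates (snd (shrink z)) v"
    and b: "\<bar>u\<bar> \<le> r" "\<bar>v\<bar> \<le> r" "\<bar>u + (1 - golden) * v\<bar> \<le> r" "\<bar>(1 - golden) * u + v\<bar> \<le> r"
      "\<bar>(1 - golden) * (u + v)\<bar> \<le> r"
    using assms by (auto simp: conj_ball_def)
  have pos: "2 - golden > 0"
    using golden_bounds by simp
  have scale: "\<bar>(2 - golden) * t\<bar> \<le> (2 - golden) * r" if "\<bar>t\<bar> \<le> r" for t
    using that pos by (simp add: abs_mult)
  have unscale: "conjugates s ((2 - golden) * w)" if "conjugates ((2 - golden) * s) w" for s w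
  proof -
    have "conjugates (golden * (golden * ((2 - golden) * s))) ((1 - golden) * ((1 - golden) * w))"
      by (intro conjugates_golden_mult that)
    then show ?thesis
      by (simp add: golden_simps)
  qed
  have "conjugates (fst z) ((2 - golden) * u)" "conjugates (snd z) ((2 - golden) * v)"
    using c by (auto intro!: unscale simp: shrink_def split: prod.splits)
  moreover have "\<bar>(2 - golden) * u + (1 - golden) * ((2 - golden) * v)\<bar> \<le> (2 - golden) * r"
    using scale[OF b(3)] by (simp add: golden_simps)
  moreover have "\<bar>(1 - golden) * ((2 - golden) * u) + (2 - golden) * v\<bar> \<le> (2 - golden) * r"
    using scale[OF b(4)] by (simp add: golden_simps)
  moreover have "\<bar>(1 - golden) * ((2 - golden) * u + (2 - golden) * v)\<bar> \<le> (2 - golden) * r"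
    using scale[OF b(5)] by (simp add: golden_simps)
  ultimately show ?thesis
    using scale[OF b(1)] scale[OF b(2)] unfolding conj_ball_def by blast
qed

text \<open>
  One descent step replaces the radius \<open>r\<close> by \<open>(2 - \<gamma>) (r + \<gamma>)\<close>. Since \<open>(2 - \<gamma>) (1 + \<gamma>) = 1\<close>, the excess of
  \<open>r\<close> over \<open>1\<close> is multiplied by \<open>2 - \<gamma> < 1 / 2\<close>, so the exponent \<open>n\<close> drops. For \<open>n = 0\<close> the radius \<open>6 / 5\<close> leaves
  only the origin, which is not in the triangle.
\<close>

lemma F_periodic_conj_ball:
  assumes "z \<in> golden_triangle" "conj_ball (1 + 2 ^ n / 5) z"
  shows "periodic F z"
  using assms
proof (induction n arbitrary: z)
  case 0
  have "fst z = 0 \<and> snd z = 0"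
    using 0 by (auto simp: conj_ball_def golden_triangle_def intro: conjugates_small_imp_0)
  then show ?case
    using 0(1) by (cases z) (auto simp: golden_triangle_def)
next
  case (Suc n)
  obtain x y where z: "z = (x, y)"
    by (cases z)
  show ?case
  proof (cases "(F ^^ 5) z = z")
    case True
    then show ?thesis
      unfolding periodic_def by (intro exI[of _ 5]) simp
  next
    case False
    then obtain w where w: "w \<in> golden_triangle" and
      near: "shrink w \<in> {(x, y), (y, 1 - x - golden * y), (x, y - (golden - 1)),
            (x - (golden - 1), y), (1 - golden * x - y, x)}"
      and per: "periodic F (shrink w) \<Longrightarrow> periodic F z"
      using pentagon_or_tower[of x y] Suc.prems(1) unfolding z by blast
    have "conj_ball (1 + 2 ^ Suc n / 5 + golden) (shrink w)"
      using conj_ball_near[OF _ near] Suc.prems(2) z by simp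
    then have "conj_ball ((2 - golden) * (1 + 2 ^ Suc n / 5 + golden)) w"
      by (rule conj_ball_shrink)
    moreover have "(2 - golden) * (1 + 2 ^ Suc n / 5 + golden) \<le> 1 + 2 ^ n / 5"
    proof -
      have "(2 - golden) * 2 ^ Suc n \<le> 1/2 * 2 ^ Suc n"
        using golden_bounds by (intro mult_right_mono) auto
      then show ?thesis
        by (simp add: golden_simps)
    qed
    ultimately have "periodic F w"
      using Suc.IH[OF w] conj_ball_mono by blast
    then show ?thesis
      using periodic_induced[of golden_triangle F shrink F, OF F_induced F_triangle w] per by blast
  qed
qed

lemma F_periodic_Z_golden:
  assumes z: "z \<in> golden_triangle" and "conjugates (fst z) u" "conjugates (snd z) v"
  shows "periodic F z"
proof -
  obtain r where "conj_ball r z"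
    using conj_ball_exists assms(2,3) by blast
  moreover obtain n where "5 * r < 2 ^ n"
    using real_arch_pow[of 2 "5 * r"] by auto
  ultimately have "conj_ball (1 + 2 ^ n / 5) z"
    by (elim conj_ball_mono) simp
  with z show ?thesis
    by (rule F_periodic_conj_ball)
qed

section \<open>Aperiodic orbits of T enter the shrunk triangle\<close>

definition digit :: "real \<times> real \<Rightarrow> int" where
  "digit z = \<lceil>fst z + golden * snd z\<rceil>"

lemma T_digit: "T z = (snd z, of_int (digit z) - fst z - golden * snd z)"
proof -
  have "- fst z - golden * snd z = - (fst z + golden * snd z)"
    by simp
  then show ?thesis
    by (cases z) (simp add: T_def digit_def frac_def ceiling_def)
qed

lemma T_inj: "inj_on T unit_square"
  using T_bij by (rule bij_betw_imp_inj_on)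

lemma T_unit_square: "z \<in> unit_square \<Longrightarrow> T z \<in> unit_square"
  using T_bij by (auto simp: bij_betw_def)

lemma T_origin: "T (0, 0) = (0, 0)"
  by (simp add: T_def)

lemma T_punctured:
  assumes "z \<in> unit_square - {(0, 0)}"
  shows "T z \<in> unit_square - {(0, 0)}"
  using assms T_unit_square[of z] inj_onD[OF T_inj, of z "(0, 0)"]
  by (auto simp: T_origin unit_square_def)

lemma digit_range:
  assumes "z \<in> unit_square - {(0, 0)}"
  shows "digit z \<in> {1, 2, 3}"
proof -
  have b: "0 \<le> fst z" "fst z < 1" "0 \<le> snd z" "snd z < 1" "fst z \<noteq> 0 \<or> snd z \<noteq> 0"
    using assms by (cases z; auto simp: unit_square_def)+
  have "golden * snd z \<le> golden * 1" "0 \<le> golden * snd z" "golden * snd z = 0 \<longleftrightarrow> snd z = 0"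
    using b golden_pos by (auto intro!: mult_left_mono)
  then have "0 < fst z + golden * snd z" "fst z + golden * snd z \<le> 3"
    using b golden_bounds by linarith+
  then have "0 < digit z" "digit z \<le> 3"
    by (auto simp: digit_def ceiling_le_iff)
  then show ?thesis
    by auto
qed

text \<open>
  With a constant digit \<open>T\<close> acts as a rotation of order five about a fixed centre.
\<close>

lemma T_period5:
  assumes "\<And>k. k < 5 \<Longrightarrow> digit ((T ^^ k) z) = n"
  shows "(T ^^ 5) z = z"
proof -
  obtain x y where z: "z = (x, y)"
    by (cases z)
  have "digit z = n" "digit (T z) = n" "digit (T (T z)) = n" "digit (T (T (T z))) = n"
     "digit (T (T (T (T z)))) = n"
    using assms[of 0] assms[of 1] assms[of 2] assms[of 3] assms[of 4] by (simp_all add: numeral_eq_Suc)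
  then show ?thesis
    by (simp add: numeral_eq_Suc T_digit golden_simps z)
qed

text \<open>
  Two steps of \<open>T\<close> with the second image expressed through the digits; that its coordinates lie in
  \<open>[0, 1)\<close> restricts which digits can follow each other.
\<close>

lemma third_coordinate:
  assumes "(x, y) \<in> unit_square"
  shows "0 \<le> of_int (digit (x, y)) - x - golden * y" "of_int (digit (x, y)) - x - golden * y < 1"
    "0 \<le> of_int (digit (T (x, y))) - golden * of_int (digit (x, y)) + golden * x + golden * y"
    "of_int (digit (T (x, y))) - golden * of_int (digit (x, y)) + golden * x + golden * y < 1"
    "T (T (x, y)) = (of_int (digit (x, y)) - x - golden * y,
       of_int (digit (T (x, y))) - golden * of_int (digit (x, y)) + golden * x + golden * y)"
proof -
  show *: "T (T (x, y)) = (of_int (digit (x, y)) - x - golden * y,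
       of_int (digit (T (x, y))) - golden * of_int (digit (x, y)) + golden * x + golden * y)"
    by (subst T_digit) (simp add: T_digit[of "(x, y)"] golden_simps)
  have "T (T (x, y)) \<in> unit_square"
    by (intro T_unit_square assms)
  then show "0 \<le> of_int (digit (x, y)) - x - golden * y" "of_int (digit (x, y)) - x - golden * y < 1"
    "0 \<le> of_int (digit (T (x, y))) - golden * of_int (digit (x, y)) + golden * x + golden * y"
    "of_int (digit (T (x, y))) - golden * of_int (digit (x, y)) + golden * x + golden * y < 1"
    unfolding * by (auto simp: unit_square_def)
qed

lemma golden_mult_sum_bounds:
  assumes "(x, y) \<in> unit_square"
  shows "0 \<le> golden * x + golden * y" "golden * x + golden * y < 2 * golden" "golden * x + y < golden + 1"
proof -
  show "0 \<le> golden * x + golden * y"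
    using assms golden_pos by (auto simp: unit_square_def)
  have "golden * (x + y) < golden * 2"
    using assms golden_pos by (intro mult_strict_left_mono) (auto simp: unit_square_def)
  then show "golden * x + golden * y < 2 * golden"
    by (simp add: algebra_simps)
  have "golden * x < golden * 1"
    using assms golden_pos by (intro mult_strict_left_mono) (auto simp: unit_square_def)
  then show "golden * x + y < golden + 1"
    using assms by (auto simp: unit_square_def)
qed

lemma digit_3_1:
  assumes "z \<in> unit_square" "digit z = 3"
  shows "digit (T z) \<noteq> 1"
  using third_coordinate[of "fst z" "snd z"] golden_mult_sum_bounds[of "fst z" "snd z"] assms golden_bounds
  by auto

lemma digit_1_3:
  assumes "z \<in> unit_square" "digit z = 1"
  shows "digit (T z) \<noteq> 3"
  using third_coordinate[of "fst z" "snd z"] golden_mult_sum_bounds[of "fst z" "snd z"] assms golden_bounds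
  by auto

lemma digit_3_2_1:
  assumes z: "z \<in> unit_square - {(0, 0)}" and d: "digit z = 3" "digit (T z) = 2"
  shows "digit (T (T z)) = 1"
proof -
  obtain x y where xy: "z = (x, y)"
    by (cases z)
  have "fst (T (T z)) + golden * snd (T (T z)) < 1"
    using third_coordinate(5)[of x y] golden_mult_sum_bounds[of x y] z d by (simp add: xy golden_simps)
  then have "digit (T (T z)) \<le> 1"
    by (simp add: digit_def ceiling_le_iff)
  then show ?thesis
    using digit_range[of "T (T z)"] T_punctured z by auto
qed

lemma digit_2_1:
  assumes z: "z \<in> unit_square - {(0, 0)}" and d: "digit z = 2" "digit (T z) = 1"
  shows "T (T z) \<in> shrink ` golden_triangle"
proof -
  obtain x y where xy: "z = (x, y)"
    by (cases z)
  have "T (T z) \<in> unit_square - {(0, 0)}"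
    by (intro T_punctured z)
  moreover have eq: "T (T z) = (2 - x - golden * y, 1 - 2 * golden + golden * x + golden * y)"
    using third_coordinate(5)[of x y] z d by (simp add: xy)
  moreover have "(golden - 1) * x < (golden - 1) * 1"
    using z golden_bounds by (intro mult_strict_left_mono) (auto simp: xy unit_square_def)
  ultimately show ?thesis
    unfolding eq shrink_image_iff by (auto simp: unit_square_def golden_simps)
qed

lemma digit_changes:
  assumes "\<not> periodic T z"
  shows "\<exists>k. digit ((T ^^ k) z) = digit z \<and> digit (T ((T ^^ k) z)) \<noteq> digit z"
proof (rule ccontr)
  assume *: "\<not> ?thesis"
  have "digit ((T ^^ k) z) = digit z" for k
    using * by (induction k) auto
  then have "(T ^^ 5) z = z"
    by (intro T_period5)
  with assms show False
    by (auto simp: periodic_def dest!: spec[of _ 5])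
qed

text \<open>
  An aperiodic orbit cannot keep a digit forever. By the digit rules it then passes from \<open>1\<close> to \<open>2\<close>,
  from \<open>3\<close> to \<open>2, 1\<close>, and from \<open>2\<close> to \<open>1\<close> or \<open>3\<close>, so that eventually a \<open>2\<close> is followed by a \<open>1\<close>, which
  leads into the shrunk triangle.
\<close>

lemma reaches_triangle:
  assumes "z \<in> unit_square - {(0, 0)}" and "\<not> periodic T z"
  shows "\<exists>k. (T ^^ k) z \<in> shrink ` golden_triangle"
proof -
  let ?N = "{z \<in> unit_square - {(0, 0)}. \<not> periodic T z}"
  let ?reach = "\<lambda>z. \<exists>k. (T ^^ k) z \<in> shrink ` golden_triangle"
  have step: "T w \<in> ?N" if "w \<in> ?N" for w
    using that T_punctured[of w] periodic_step_iff[of T unit_square w] T_inj T_unit_square by auto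
  have reach: "?reach w" if "?reach ((T ^^ k) w)" for w k
  proof -
    from that obtain j where "(T ^^ j) ((T ^^ k) w) \<in> shrink ` golden_triangle" ..
    then have "(T ^^ (j + k)) w \<in> shrink ` golden_triangle"
      by (simp add: funpow_add)
    then show ?thesis ..
  qed
  have change: "\<exists>v k. v = (T ^^ k) w \<and> v \<in> ?N \<and> digit v = digit w \<and> digit (T v) \<noteq> digit w"
    if "w \<in> ?N" for w
  proof -
    obtain k where "digit ((T ^^ k) w) = digit w" "digit (T ((T ^^ k) w)) \<noteq> digit w"
      using digit_changes[of w] \<open>w \<in> ?N\<close> by auto
    moreover have "(T ^^ k) w \<in> ?N"
      using step \<open>w \<in> ?N\<close> by (rule funpow_mem)
    ultimately show ?thesis
      by blast
  qed
  have reach3: "?reach w" if w: "w \<in> ?N" "digit w = 3" for w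
  proof -
    obtain v k where v: "v = (T ^^ k) w" "v \<in> ?N" "digit v = 3" "digit (T v) \<noteq> 3"
      using change[OF w(1)] unfolding w(2) by blast
    have 2: "digit (T v) = 2"
      using digit_range[of "T v"] digit_3_1[of v] step[OF v(2)] v by auto
    have "(T ^^ 2) (T v) \<in> shrink ` golden_triangle"
      using digit_2_1[of "T v"] digit_3_2_1[of v] step[OF v(2)] v 2 by (simp add: numeral_eq_Suc)
    then show ?thesis
      using reach[of k w] reach[of 1 v] v(1) by auto
  qed
  have reach2: "?reach w" if w: "w \<in> ?N" "digit w = 2" for w
  proof -
    obtain v k where v: "v = (T ^^ k) w" "v \<in> ?N" "digit v = 2" "digit (T v) \<noteq> 2"
      using change[OF w(1)] unfolding w(2) by blast
    have "?reach v"
    proof (cases "digit (T v) = 1")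
      case True
      then have "(T ^^ 2) v \<in> shrink ` golden_triangle"
        using digit_2_1[of v] v by (simp add: numeral_eq_Suc)
      then show ?thesis by blast
    next
      case False
      then have "digit (T v) = 3"
        using digit_range[of "T v"] step[OF v(2)] v by auto
      then show ?thesis
        using reach[of 1 v] reach3 step[OF v(2)] by auto
    qed
    then show ?thesis
      using reach v(1) by blast
  qed
  have reach1: "?reach w" if w: "w \<in> ?N" "digit w = 1" for w
  proof -
    obtain v k where v: "v = (T ^^ k) w" "v \<in> ?N" "digit v = 1" "digit (T v) \<noteq> 1"
      using change[OF w(1)] unfolding w(2) by blast
    have "digit (T v) = 2"
      using digit_range[of "T v"] digit_1_3[of v] step[OF v(2)] v by auto
    then have "?reach v"
      using reach[of 1 v] reach2 step[OF v(2)] by auto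
    then show ?thesis
      using reach v(1) by blast
  qed
  show ?thesis
    using digit_range[of z] reach1 reach2 reach3 assms by blast
qed

lemma T_conjugates:
  assumes "\<exists>u. conjugates (fst z) u" "\<exists>v. conjugates (snd z) v"
  shows "(\<exists>u. conjugates (fst (T z)) u) \<and> (\<exists>v. conjugates (snd (T z)) v)"
proof -
  obtain u v where uv: "conjugates (fst z) u" "conjugates (snd z) v"
    using assms by blast
  have "conjugates (snd (T z)) (of_int (digit z) - u - (1 - golden) * v)"
    unfolding T_digit snd_conv by (intro conjugates_intros conjugates_of_int uv)
  with uv show ?thesis
    by (auto simp: T_digit)
qed

lemma T_periodic_Z_golden:
  assumes "z \<in> unit_square" "fst z \<in> Z_golden" "snd z \<in> Z_golden"
  shows "periodic T z"
proof (rule ccontr)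
  assume np: "\<not> periodic T z"
  have "periodic T (0, 0)"
    unfolding periodic_def by (rule exI[of _ 1]) (simp add: T_origin)
  with np assms obtain k w where w: "w \<in> golden_triangle" "(T ^^ k) z = shrink w"
    using reaches_triangle[of z] by (metis DiffI imageE singletonD)
  have "(\<exists>u. conjugates (fst ((T ^^ k) z)) u) \<and> (\<exists>v. conjugates (snd ((T ^^ k) z)) v)" for k
    using assms by (induction k) (auto simp: Z_golden_conjugates T_conjugates)
  then obtain u v where uv: "conjugates (fst (shrink w)) u" "conjugates (snd (shrink w)) v"
    using w(2) by metis
  then have "\<exists>r. conj_ball r (shrink w)"
    by (rule conj_ball_exists)
  then obtain u v where "conjugates (fst w) u" "conjugates (snd w) v"
    using conj_ball_shrink conj_ball_def by blast
  then have "periodic F w"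
    using F_periodic_Z_golden w(1) by blast
  then have "periodic T (shrink w)"
    using periodic_induced[of golden_triangle T shrink F, OF T_induced F_triangle w(1)] by blast
  then show False
    using periodic_funpow_iff[of T unit_square z k] T_inj T_unit_square assms(1) np w(2) by auto
qed

section \<open>The aperiodic point\<close>

lemma shrink_triangle: "z \<in> golden_triangle \<Longrightarrow> shrink z \<in> golden_triangle"
  using shrink_image_subset by blast

lemma shrink_funpow: "(shrink ^^ n) (x, y) = ((2 - golden) ^ n * x, (2 - golden) ^ n * y)"
  by (induction n) (simp_all add: shrink_def)

lemma F_reaches_shrink_funpow:
  assumes "z \<in> golden_triangle" "(F ^^ m) z = w"
  shows "\<exists>k. (F ^^ k) ((shrink ^^ n) z) = (shrink ^^ n) w"
proof (induction n)
  case (Suc n)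
  then obtain k where "(F ^^ k) ((shrink ^^ n) z) = (shrink ^^ n) w" ..
  moreover have "(shrink ^^ n) z \<in> golden_triangle"
    by (intro funpow_mem shrink_triangle assms)
  ultimately show ?case
    using funpow_induced[of golden_triangle F shrink F "(shrink ^^ n) z" k, OF F_induced F_triangle] by auto
qed (use assms in auto)

lemma F_orbit_two_thirds: "(F ^^ 2) (2/3, 0) = (shrink ^^ 2) (1/3, 0)"
proof -
  have "F (2/3, 0) = (0, golden - 2/3)"
    using golden_bounds by (simp add: F_def)
  moreover have "F (0, golden - 2/3) = (5/3 - golden, 0)"
    using golden_bounds by (simp add: F_def)
  ultimately show ?thesis
    by (simp add: numeral_eq_Suc shrink_def golden_simps add_divide_distrib)
qed

lemma F_orbit_one_third: "(F ^^ 8) (1/3, 0) = (shrink ^^ 2) (2/3, 0)"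
proof -
  have "F (1/3, 0) = (1 - golden / 3, 1/3)"
    using golden_bounds by (simp add: F_def)
  moreover have "F (1 - golden / 3, 1/3) = (1/3, golden - 1)"
    using golden_bounds by (simp add: F_def golden_simps add_divide_distrib)
  moreover have "F (1/3, golden - 1) = (golden - 1, golden - 4/3)"
    using golden_bounds by (simp add: F_def golden_simps add_divide_distrib)
  moreover have "F (golden - 1, golden - 4/3) = (golden - 4/3, golden / 3)"
    using golden_bounds by (simp add: F_def golden_simps add_divide_distrib)
  moreover have "F (golden - 4/3, golden / 3) = (0, golden - 4/3)"
    using golden_bounds by (simp add: F_def golden_simps add_divide_distrib)
  moreover have "F (0, golden - 4/3) = (7/3 - golden, 0)"
    using golden_bounds by (simp add: F_def golden_simps add_divide_distrib)
  moreover have "F (7/3 - golden, 0) = (0, 2 * golden - 7/3)"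
    using golden_bounds by (simp add: F_def golden_simps add_divide_distrib)
  moreover have "F (0, 2 * golden - 7/3) = (10/3 - 2 * golden, 0)"
    using golden_bounds by (simp add: F_def golden_simps add_divide_distrib)
  ultimately show ?thesis
    by (simp add: numeral_eq_Suc shrink_def golden_simps add_divide_distrib)
qed

text \<open>
  \<open>(2/3, 0)\<close> leads to a twice shrunk \<open>(1/3, 0)\<close>, which in turn leads to a further twice shrunk
  \<open>(2/3, 0)\<close>; this round trip can be repeated at every scale.
\<close>

lemma F_reaches_two_thirds: "\<exists>k. (F ^^ k) (2/3, 0) = (shrink ^^ (4 * n)) (2/3, 0)"
proof (induction n)
  case (Suc n)
  have mem: "(2/3, 0) \<in> golden_triangle" "(1/3, 0) \<in> golden_triangle"
    by (simp_all add: golden_triangle_def)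
  obtain j where j: "(F ^^ j) ((shrink ^^ 2) (1/3, 0)) = (shrink ^^ 2) ((shrink ^^ 2) (2/3, 0))"
    using F_reaches_shrink_funpow[OF mem(2) F_orbit_one_third] by blast
  have "(F ^^ (j + 2)) (2/3, 0) = (shrink ^^ 4) (2/3, 0)"
    by (simp only: funpow_add o_apply F_orbit_two_thirds j) (simp add: numeral_eq_Suc)
  then obtain i where i: "(F ^^ i) ((shrink ^^ (4 * n)) (2/3, 0)) = (shrink ^^ (4 * n)) ((shrink ^^ 4) (2/3, 0))"
    using F_reaches_shrink_funpow[OF mem(1)] by blast
  obtain k where k: "(F ^^ k) (2/3, 0) = (shrink ^^ (4 * n)) (2/3, 0)"
    using Suc by blast
  have "(F ^^ (i + k)) (2/3, 0) = (shrink ^^ (4 * n + 4)) (2/3, 0)"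
    by (simp only: funpow_add o_apply k i)
  then show ?case
    by (auto simp: add.commute)
qed (auto intro: exI[of _ 0])

lemma T_aperiodic: "\<not> periodic T (1 - 1 / (3 * golden), 1 - 2 / (3 * golden))"
proof
  let ?z = "(1 - 1 / (3 * golden), 1 - 2 / (3 * golden))"
  let ?s = "\<lambda>n. (shrink ^^ (4 * n + 1)) (2/3, 0)"
  assume per: "periodic T ?z"
  have inv: "1 / golden = golden - 1"
    using golden_pos by (simp add: field_simps golden_sq)
  have z: "?z = (4/3 - golden / 3, 5/3 - 2 * golden / 3)"
    using inv by (simp add: field_simps)
  have 1: "T (4/3 - golden / 3, 5/3 - 2 * golden / 3) = (5/3 - 2 * golden / 3, 4/3 - 2 * golden / 3)"
    using T_eqI[of 2 "4/3 - golden / 3" "5/3 - 2 * golden / 3"] golden_bounds by (simp add: golden_simps add_divide_distrib)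
  have 2: "T (5/3 - 2 * golden / 3, 4/3 - 2 * golden / 3) = (4/3 - 2 * golden / 3, 0)"
    using T_eqI[of 1 "5/3 - 2 * golden / 3" "4/3 - 2 * golden / 3"] golden_bounds by (simp add: golden_simps add_divide_distrib)
  have start: "(T ^^ 2) ?z = shrink (2/3, 0)"
  proof -
    have "(T ^^ 2) ?z = (4/3 - 2 * golden / 3, 0)"
      unfolding z by (simp only: numeral_2_eq_2 funpow.simps o_apply id_apply 1 2)
    then show ?thesis
      by (simp add: shrink_def golden_simps)
  qed
  have "?s n \<in> range (\<lambda>n. (T ^^ n) ?z)" for n
  proof -
    obtain k where k: "(F ^^ k) (2/3, 0) = (shrink ^^ (4 * n)) (2/3, 0)"
      using F_reaches_two_thirds by blast
    have "(2/3, 0) \<in> golden_triangle"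
      by (simp add: golden_triangle_def)
    then obtain j where "(T ^^ j) (shrink (2/3, 0)) = shrink ((F ^^ k) (2/3, 0))"
      using funpow_induced[of golden_triangle T shrink F _ k, OF T_induced F_triangle] by blast
    then have "(T ^^ (j + 2)) ?z = ?s n"
      by (simp only: funpow_add o_apply start k) (simp add: funpow_swap1)
    then show ?thesis
      by (metis rangeI)
  qed
  then have "finite (range ?s)"
    using periodic_finite_orbit[OF per] by (meson finite_subset image_subsetI)
  moreover have "inj ?s"
  proof (rule linorder_injI)
    fix m n :: nat assume "m < n"
    then have "(2 - golden) ^ (4 * n + 1) < (2 - golden) ^ (4 * m + 1)"
      using golden_bounds by (intro power_strict_decreasing) auto
    then show "?s m \<noteq> ?s n"
      by (simp add: shrink_funpow del: power_Suc funpow.simps)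
  qed
  ultimately show False
    using finite_imageD infinite_UNIV_nat by blast
qed

theorem theorem4p2:
  shows "(\<forall>z \<in> (Z_golden \<inter> {0..<1}) \<times> (Z_golden \<inter> {0..<1}). period T z \<noteq> \<infinity>) \<and>
         period T (1 - 1 / (3 * golden), 1 - 2 / (3 * golden)) = \<infinity>"
proof
  have "periodic T z" if "z \<in> (Z_golden \<inter> {0..<1}) \<times> (Z_golden \<inter> {0..<1})" for z
    using that by (intro T_periodic_Z_golden) (simp_all add: mem_Times_iff unit_square_def)
  then show "\<forall>z \<in> (Z_golden \<inter> {0..<1}) \<times> (Z_golden \<inter> {0..<1}). period T z \<noteq> \<infinity>"
    by (simp only: period_finite_iff) simp
  show "period T (1 - 1 / (3 * golden), 1 - 2 / (3 * golden)) = \<infinity>"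
    using T_aperiodic by (metis period_finite_iff)
qed

end
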